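(* Let $(K,v)$ be a henselian valued field such that the residue field $Kv$ is hilbertian. Then $v$ is $\emptyset$-definable.
   Context: A field $F$ is hilbertian if for every polynomial $f\in F[T,X]$ which is separable, irreducible and monic when considered as a polynomial in $F(T)[X]$ there is some $a\in F$ such that $f(a,X)$ is irreducible in $F[X]$. A valuation $v$ on $K$ is $\emptyset$-definable if there is a parameter-free first-order formula in the language of rings defining its valuation ring $\mathcal{O}_v$ in $K$. *)

theory Defs
  imports "HOL-Algebra.Algebraic_Closure_Type"
begin

section \<open>Henselian valued fields\<close>

text \<open>
  A valuation on a field is represented by its restriction to the nonzero elements, written
  additively: the value of \<open>v\<close> at \<open>0\<close>, mathematically infinity, is left unspecified, and every
  use of \<open>v\<close> below is guarded accordingly. The value group is the image of the nonzero elements,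
  an ordered subgroup of \<open>'g\<close>. The trivial valuation is allowed.
\<close>

definition valuation :: "('a::field \<Rightarrow> 'g::linordered_ab_group_add) \<Rightarrow> bool" where
  "valuation v \<longleftrightarrow>
     (\<forall>x y. x \<noteq> 0 \<longrightarrow> y \<noteq> 0 \<longrightarrow> v (x * y) = v x + v y) \<and>
     (\<forall>x y. x \<noteq> 0 \<longrightarrow> y \<noteq> 0 \<longrightarrow> x + y \<noteq> 0 \<longrightarrow> min (v x) (v y) \<le> v (x + y))"

definition valuation_ring :: "('a::field \<Rightarrow> 'g::linordered_ab_group_add) \<Rightarrow> 'a set" where
  "valuation_ring v = {x. x = 0 \<or> 0 \<le> v x}"

definition valuation_ideal :: "('a::field \<Rightarrow> 'g::linordered_ab_group_add) \<Rightarrow> 'a set" where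
  "valuation_ideal v = {x. x = 0 \<or> 0 < v x}"

text \<open>
  The residue field, the quotient of the valuation ring by its maximal ideal, depends on the
  term \<open>v\<close> and so cannot be a type. It is represented by a field type \<open>'k\<close> together with the
  quotient map, a surjective ring homomorphism from the valuation ring to \<open>'k\<close> with kernel the
  maximal ideal; this determines \<open>'k\<close> up to isomorphism. The values of \<open>res\<close> outside the
  valuation ring are irrelevant.
\<close>

definition residue_map ::
    "('a::field \<Rightarrow> 'g::linordered_ab_group_add) \<Rightarrow> ('a \<Rightarrow> 'k::field) \<Rightarrow> bool" where
  "residue_map v res \<longleftrightarrow>
     res 1 = 1 \<and>
     (\<forall>x\<in>valuation_ring v. \<forall>y\<in>valuation_ring v. res (x + y) = res x + res y) \<and>
     (\<forall>x\<in>valuation_ring v. \<forall>y\<in>valuation_ring v. res (x * y) = res x * res y) \<and>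
     res ` valuation_ring v = UNIV \<and>
     {x \<in> valuation_ring v. res x = 0} = valuation_ideal v"

text \<open>
  Henselianity is Hensel's lemma: for every polynomial over the valuation ring, a simple zero of
  its reduction lifts to a zero in the valuation ring.
\<close>

definition henselian :: "('a::field \<Rightarrow> 'g::linordered_ab_group_add) \<Rightarrow> bool" where
  "henselian v \<longleftrightarrow>
     (\<forall>f. \<forall>a\<in>valuation_ring v.
        (\<forall>i. Polynomial.coeff f i \<in> valuation_ring v) \<longrightarrow>
        poly f a \<in> valuation_ideal v \<longrightarrow>
        poly (pderiv f) a \<notin> valuation_ideal v \<longrightarrow>
        (\<exists>b\<in>valuation_ring v. poly f b = 0 \<and> b - a \<in> valuation_ideal v))"

section \<open>Hilbertian fields\<close>

text \<open>A polynomial is separable if it has no multiple zeros in an algebraic closure.\<close>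

definition separable :: "'a::field poly \<Rightarrow> bool" where
  "separable p \<longleftrightarrow> rsquarefree (map_poly to_ac p)"

text \<open>
  The ring \<open>F[T,X]\<close> is \<open>'k poly poly\<close>, the inner variable being \<open>T\<close> and the outer one \<open>X\<close>;
  \<open>F(T)\<close> is \<open>'k poly fract\<close>.
\<close>

definition hilbertian :: "'k::field itself \<Rightarrow> bool" where
  "hilbertian _ \<longleftrightarrow>
     (\<forall>f :: 'k poly poly.
        separable (fract_poly f) \<longrightarrow>
        Factorial_Ring.irreducible (fract_poly f) \<longrightarrow>
        Polynomial.lead_coeff (fract_poly f) = 1 \<longrightarrow>
        (\<exists>a. Factorial_Ring.irreducible (map_poly (\<lambda>c. poly c a) f)))"

section \<open>Parameter-free definability in the language of rings\<close>

datatype ring_term =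
    RVar nat
  | RZero
  | ROne
  | RNeg ring_term
  | RAdd ring_term ring_term
  | RMul ring_term ring_term

datatype ring_formula =
    REq ring_term ring_term
  | RNot ring_formula
  | RAnd ring_formula ring_formula
  | REx nat ring_formula

primrec term_vars :: "ring_term \<Rightarrow> nat set" where
  "term_vars (RVar n) = {n}"
| "term_vars RZero = {}"
| "term_vars ROne = {}"
| "term_vars (RNeg t) = term_vars t"
| "term_vars (RAdd s t) = term_vars s \<union> term_vars t"
| "term_vars (RMul s t) = term_vars s \<union> term_vars t"

primrec free_vars :: "ring_formula \<Rightarrow> nat set" where
  "free_vars (REq s t) = term_vars s \<union> term_vars t"
| "free_vars (RNot \<phi>) = free_vars \<phi>"
| "free_vars (RAnd \<phi> \<psi>) = free_vars \<phi> \<union> free_vars \<psi>"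
| "free_vars (REx n \<phi>) = free_vars \<phi> - {n}"

primrec term_value :: "(nat \<Rightarrow> 'a::field) \<Rightarrow> ring_term \<Rightarrow> 'a" where
  "term_value e (RVar n) = e n"
| "term_value e RZero = 0"
| "term_value e ROne = 1"
| "term_value e (RNeg t) = - term_value e t"
| "term_value e (RAdd s t) = term_value e s + term_value e t"
| "term_value e (RMul s t) = term_value e s * term_value e t"

primrec holds :: "(nat \<Rightarrow> 'a::field) \<Rightarrow> ring_formula \<Rightarrow> bool" where
  "holds e (REq s t) \<longleftrightarrow> term_value e s = term_value e t"
| "holds e (RNot \<phi>) \<longleftrightarrow> \<not> holds e \<phi>"
| "holds e (RAnd \<phi> \<psi>) \<longleftrightarrow> holds e \<phi> \<and> holds e \<psi>"
| "holds e (REx n \<phi>) \<longleftrightarrow> (\<exists>x. holds (e(n := x)) \<phi>)"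

text \<open>
  Since \<open>0\<close> is the only variable allowed to occur free, quantifying over whole assignments
  introduces no parameters.
\<close>

definition zero_definable :: "'a::field set \<Rightarrow> bool" where
  "zero_definable S \<longleftrightarrow>
     (\<exists>\<phi>. free_vars \<phi> \<subseteq> {0} \<and> (\<forall>e. e 0 \<in> S \<longleftrightarrow> holds e \<phi>))"

definition zero_definable_valuation ::
    "('a::field \<Rightarrow> 'g::linordered_ab_group_add) \<Rightarrow> bool" where
  "zero_definable_valuation v \<longleftrightarrow> zero_definable (valuation_ring v)"

end

theory Submission
  imports Defs
begin

text \<open>
  Let \<open>h T = T\<^sup>2 + T + d\<close> be irreducible over the residue field. Then \<open>1 / h\<close> maps the whole field
  into the valuation ring, which frees the definition of bounded subsets from any prior knowledge
  of the valuation. The fractions \<open>1 / h b\<close> cover \<open>1 / d\<close> plus the maximal ideal by Hensel's lemma,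
  and among the elements \<open>x = 1 / h b - 1 / d\<close> the nonunits are singled out by the condition that
  \<open>X\<^sup>2 + X + x / h a\<close> has a zero for every \<open>a\<close>: for \<open>x\<close> a unit, Hilbert irreducibility provides an
  \<open>a\<close> where it has none. This defines the maximal ideal with the parameter \<open>d\<close>.

  The parameter disappears because, again by Hilbert irreducibility, every set resembling the
  maximal ideal of a valuation ring in which \<open>X\<^sup>2 + X + c\<close> has a zero for \<open>c\<close> in that set is already
  contained in the maximal ideal. So the latter is the union of those sets defined with an
  arbitrary parameter that satisfy finitely many first-order conditions.
\<close>

section \<open>Quadratic polynomials over hilbertian fields\<close>

text \<open>A proper factorization would split degree 2 as 1 + 1, and a factor of degree 1 has a
  zero.\<close>

lemma irreducible_quadratic:
  fixes p q :: "'a::field"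
  assumes no_root: "\<And>z. z\<^sup>2 + p * z + q \<noteq> 0"
  shows "Factorial_Ring.irreducible [:q, p, 1:]"
proof (rule Factorial_Ring.irreducibleI)
  fix a b assume ab: "[:q, p, 1:] = a * b"
  then have nz: "a \<noteq> 0" "b \<noteq> 0" by auto
  have linear_root: "\<exists>z. poly c z = 0" if "Polynomial.degree c = 1" for c :: "'a poly"
  proof -
    obtain s r where "c = pCons s r"
      by (cases c)
    then obtain t where c: "c = [:s, t:]" "t \<noteq> 0"
      using \<open>Polynomial.degree c = 1\<close>
      by (auto simp: degree_pCons_eq_if split: if_splits elim!: degree_eq_zeroE)
    then have "poly c (- s / t) = 0" by simp
    then show ?thesis ..
  qed
  have root: "poly (a * b) z \<noteq> 0" for z
    using no_root[of z] unfolding ab[symmetric] by (simp add: algebra_simps power2_eq_square)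
  have "Polynomial.degree a + Polynomial.degree b = 2"
    using nz by (simp flip: degree_mult_eq ab)
  moreover have "Polynomial.degree a \<noteq> 1" "Polynomial.degree b \<noteq> 1"
    using linear_root[of a] linear_root[of b] root by auto
  ultimately have "Polynomial.degree a = 0 \<or> Polynomial.degree b = 0"
    by linarith
  then show "a dvd 1 \<or> b dvd 1"
    using nz by (simp add: is_unit_iff_degree)
qed (auto simp: is_unit_iff_degree)

lemma no_root_if_irreducible_quadratic:
  fixes p q :: "'a::field"
  assumes "Factorial_Ring.irreducible [:q, p, 1:]"
  shows "z\<^sup>2 + p * z + q \<noteq> 0"
proof
  assume z: "z\<^sup>2 + p * z + q = 0"
  have "[:q, p, 1:] = [:-z, 1:] * [:p + z, 1:]"
    using z by (simp add: algebra_simps power2_eq_square eq_neg_iff_add_eq_0)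
  then have "[:-z, 1:] dvd 1 \<or> [:p + z, 1:] dvd 1"
    using assms Factorial_Ring.irreducibleD by blast
  then show False
    by (simp add: is_unit_iff_degree)
qed

text \<open>Over the algebraic closure a double zero \<open>a\<close> forces the polynomial to be (X
  - a)^2, whose coefficients satisfy p^2 = 4q. This is uniform in the characteristic.\<close>

lemma separable_quadratic:
  fixes p q :: "'a::field"
  assumes disc: "p\<^sup>2 \<noteq> 4 * q"
  shows "separable [:q, p, 1:]"
proof -
  have "Polynomial.order a [:to_ac q, to_ac p, 1:] \<le> 1" for a
  proof (rule ccontr)
    assume "\<not> Polynomial.order a [:to_ac q, to_ac p, 1:] \<le> 1"
    then have "[:-a, 1:] ^ 2 dvd [:to_ac q, to_ac p, 1:]"
      by (subst order_divides) auto
    then obtain r where r: "[:to_ac q, to_ac p, 1:] = [:-a, 1:] ^ 2 * r"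
      by (rule dvdE)
    then have "r \<noteq> 0" by auto
    then have "Polynomial.degree ([:-a, 1:] ^ 2 * r) = 2 + Polynomial.degree r"
      by (simp add: degree_mult_eq degree_linear_power)
    then have "Polynomial.degree r = 0"
      unfolding r[symmetric] by simp
    then obtain c where "r = [:c:]"
      by (rule degree_eq_zeroE)
    then have "to_ac q = a\<^sup>2 * c" "to_ac p = - 2 * a * c" "c = 1"
      using r by (simp_all add: power2_eq_square)
    then have "to_ac (p\<^sup>2) = to_ac (4 * q)"
      by (simp add: power2_eq_square)
    then show False
      using disc by (simp only: to_ac_eq_iff)
  qed
  then have "rsquarefree [:to_ac q, to_ac p, 1:]"
    unfolding rsquarefree_def by (auto simp: le_Suc_eq)
  then show ?thesis
    unfolding separable_def by (simp add: map_poly_pCons)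
qed

lemma to_fract_numeral: "to_fract (numeral n) = numeral n"
proof -
  have "to_fract (of_nat m) = of_nat m" for m
    by (induction m) simp_all
  from this[of "numeral n"] show ?thesis
    by (simp only: of_nat_numeral)
qed

text \<open>The hypothesis \<open>no_root\<close> excludes a zero A/B in F(T) with denominators
  cleared, so that applications can argue by degree and divisibility in F[T].\<close>

lemma hilbertian_quadratic:
  fixes p q :: "'k::field poly"
  assumes hilb: "hilbertian TYPE('k)"
    and disc: "p\<^sup>2 \<noteq> 4 * q"
    and no_root: "\<And>A B. A\<^sup>2 + p * A * B + q * B\<^sup>2 = 0 \<Longrightarrow> B = 0"
  obtains a where "\<And>z. z\<^sup>2 + poly p a * z + poly q a \<noteq> 0"
proof -
  let ?f = "[:q, p, 1:]"
  have f: "fract_poly ?f = [:to_fract q, to_fract p, 1:]"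
    by (simp add: map_poly_pCons)
  have "separable (fract_poly ?f)"
    unfolding f
  proof (rule separable_quadratic)
    show "(to_fract p)\<^sup>2 \<noteq> 4 * to_fract q"
    proof
      assume "(to_fract p)\<^sup>2 = 4 * to_fract q"
      then have "to_fract (p\<^sup>2) = to_fract (4 * q)"
        by (simp only: power2_eq_square to_fract_mult to_fract_numeral)
      then show False
        using disc by (simp only: to_fract_eq_iff)
    qed
  qed
  moreover have "Factorial_Ring.irreducible (fract_poly ?f)"
    unfolding f
  proof (rule irreducible_quadratic)
    fix z :: "'k poly fract"
    obtain A B where z: "z = Fract A B" "B \<noteq> 0"
      by (cases z)
    have zB: "z * to_fract B = to_fract A"
      using z by (simp add: Fract_conv_to_fract)
    show "z\<^sup>2 + to_fract p * z + to_fract q \<noteq> 0"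
    proof
      assume "z\<^sup>2 + to_fract p * z + to_fract q = 0"
      then have "(z\<^sup>2 + to_fract p * z + to_fract q) * (to_fract B)\<^sup>2 = 0"
        by simp
      then have "(z * to_fract B)\<^sup>2 + to_fract p * (z * to_fract B) * to_fract B
          + to_fract q * (to_fract B)\<^sup>2 = 0"
        by (simp add: algebra_simps power2_eq_square)
      then have "to_fract (A\<^sup>2 + p * A * B + q * B\<^sup>2) = 0"
        unfolding zB by (simp add: power2_eq_square)
      then have "A\<^sup>2 + p * A * B + q * B\<^sup>2 = 0"
        by (simp only: to_fract_eq_0_iff)
      then show False
        using no_root z by blast
    qed
  qed
  moreover have "Polynomial.lead_coeff (fract_poly ?f) = 1"
    by (simp add: f)
  ultimately obtain a where "Factorial_Ring.irreducible (map_poly (\<lambda>c. poly c a) ?f)"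
    using hilb unfolding hilbertian_def by blast
  then have "Factorial_Ring.irreducible [:poly q a, poly p a, 1:]"
    by (simp add: map_poly_pCons)
  from no_root_if_irreducible_quadratic[OF this] show thesis
    by (rule that)
qed

text \<open>Specializes X^2 + X + T. A zero A/B would give T B^2 = -A(A + B), where the left side
  has odd degree while the right side has even degree or too small a degree.\<close>

lemma hilbertian_obtains_irreducible:
  assumes hilb: "hilbertian TYPE('k::field)"
  obtains d :: "'k::field" where "\<And>z. z\<^sup>2 + z + d \<noteq> 0"
proof -
  define T :: "'k poly" where "T = [:0, 1:]"
  have "1\<^sup>2 \<noteq> 4 * T"
  proof
    assume "1\<^sup>2 = 4 * T"
    then have "poly (1\<^sup>2) 0 = poly (4 * T) 0" by simp
    then show False by (simp add: T_def)
  qed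
  moreover have "B = 0" if "A\<^sup>2 + 1 * A * B + T * B\<^sup>2 = 0" for A B :: "'k poly"
  proof (rule ccontr)
    assume B: "B \<noteq> 0"
    have T: "Polynomial.degree (T * B\<^sup>2) = 1 + 2 * Polynomial.degree B"
      using B by (simp add: T_def degree_mult_eq power2_eq_square)
    have eq: "T * B\<^sup>2 = - (A * (A + B))"
      using \<open>A\<^sup>2 + 1 * A * B + T * B\<^sup>2 = 0\<close>
      by (simp add: power2_eq_square eq_neg_iff_add_eq_0 algebra_simps)
    show False
    proof (cases "Polynomial.degree A \<le> Polynomial.degree B")
      case True
      then have "Polynomial.degree (A * (A + B)) \<le> 2 * Polynomial.degree B"
        using degree_mult_le[of A "A + B"] degree_add_le[of A "Polynomial.degree B" B] by simp
      then show False
        using T eq by simp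
    next
      case False
      then have "A \<noteq> 0" "A + B \<noteq> 0" "Polynomial.degree (A + B) = Polynomial.degree A"
        by (auto simp: degree_add_eq_left dest: arg_cong[where f = Polynomial.degree]
            simp: add_eq_0_iff)
      then have "Polynomial.degree (A * (A + B)) = 2 * Polynomial.degree A"
        by (simp add: degree_mult_eq)
      then have "1 + 2 * Polynomial.degree B = 2 * Polynomial.degree A"
        using T eq by simp
      then show False by presburger
    qed
  qed
  ultimately obtain a where "\<And>z. z\<^sup>2 + poly 1 a * z + poly T a \<noteq> 0"
    using hilbertian_quadratic[OF hilb] by blast
  then show thesis
    by (intro that[of a]) (simp add: T_def)
qed

text \<open>
  The point of \<open>X\<^sup>2 + X + c / h\<close> is that \<open>h\<close> has no zero, so that \<open>c / h\<close> has a pole at no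
  rational place; Hilbert irreducibility applies because \<open>h\<close> divides \<open>c / h\<close> to an odd power.
\<close>

lemma hilbertian_obtains_quotient:
  fixes c d :: "'k::field"
  assumes hilb: "hilbertian TYPE('k)"
    and h: "\<And>z. z\<^sup>2 + z + d \<noteq> 0"
    and c: "c \<noteq> 0"
  obtains a where "\<And>z. (a\<^sup>2 + a + d) * (z\<^sup>2 + z) + c \<noteq> 0"
proof -
  define H where "H = [:d, 1, 1:]"
  have "prime_elem H"
    unfolding H_def using irreducible_quadratic[of 1 d] h
    by (intro field_poly_irreducible_imp_prime) auto
  have nz: "H \<noteq> 0" and deg: "Polynomial.degree H = 2"
    by (simp_all add: H_def)
  \<comment> \<open>The polynomial specialized is X^2 + HX + cH, which is X^2 + X + c/H with its
    zeros multiplied by H to clear the denominator.\<close>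
  have "H\<^sup>2 \<noteq> 4 * Polynomial.smult c H"
  proof
    assume "H\<^sup>2 = 4 * Polynomial.smult c H"
    then have "H * (H - [:4 * c:]) = 0"
      by (simp add: power2_eq_square algebra_simps numeral_poly)
    then show False
      by (simp add: H_def)
  qed
  \<comment> \<open>Infinite descent at the prime H: it divides A, then B, and cancelling it leaves
    a solution of the same equation with B of smaller degree.\<close>
  moreover have "B = 0" if "A\<^sup>2 + H * A * B + Polynomial.smult c H * B\<^sup>2 = 0" for A B
    using that
  proof (induction "Polynomial.degree B" arbitrary: A B rule: less_induct)
    case less
    have "A\<^sup>2 = H * - (A * B + Polynomial.smult c (B\<^sup>2))"
      using less.prems by (simp add: algebra_simps eq_neg_iff_add_eq_0)
    then have "H dvd A\<^sup>2" by (metis dvd_triv_left)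
    then have "H dvd A" using \<open>prime_elem H\<close> by (metis prime_elem_dvd_power)
    then obtain A' where A': "A = H * A'" by (rule dvdE)
    have "H * (Polynomial.smult c (B\<^sup>2) + H * (A'\<^sup>2 + A' * B)) = 0"
      using less.prems unfolding A' by (simp add: algebra_simps power2_eq_square)
    then have A'_eq: "Polynomial.smult c (B\<^sup>2) + H * (A'\<^sup>2 + A' * B) = 0"
      using nz by simp
    then have "Polynomial.smult c (B\<^sup>2) = H * - (A'\<^sup>2 + A' * B)"
      by (simp only: eq_neg_iff_add_eq_0 mult_minus_right)
    then have "H dvd Polynomial.smult c (B\<^sup>2)" by (metis dvd_triv_left)
    then have "H dvd B" using \<open>prime_elem H\<close> c by (metis prime_elem_dvd_power dvd_smult_cancel)
    then obtain B' where B': "B = H * B'" by (rule dvdE)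
    have "H * (A'\<^sup>2 + H * A' * B' + Polynomial.smult c H * B'\<^sup>2) = 0"
      using A'_eq unfolding B' by (simp add: algebra_simps power2_eq_square)
    then have eq': "A'\<^sup>2 + H * A' * B' + Polynomial.smult c H * B'\<^sup>2 = 0"
      using nz by simp
    show "B = 0"
    proof (rule ccontr)
      assume "B \<noteq> 0"
      then have "B' \<noteq> 0" "Polynomial.degree B = 2 + Polynomial.degree B'"
        using nz by (auto simp: B' degree_mult_eq deg)
      then show False
        using less.hyps[OF _ eq'] by simp
    qed
  qed
  ultimately obtain a where
    a: "\<And>z. z\<^sup>2 + poly H a * z + poly (Polynomial.smult c H) a \<noteq> 0"
    using hilbertian_quadratic[OF hilb] by blast
  have H_a: "poly H a = a\<^sup>2 + a + d"
    by (simp add: H_def algebra_simps power2_eq_square)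
  have "(a\<^sup>2 + a + d) * (z\<^sup>2 + z) + c \<noteq> 0" for z
  proof
    assume "(a\<^sup>2 + a + d) * (z\<^sup>2 + z) + c = 0"
    then have "poly H a * (poly H a * (z\<^sup>2 + z) + c) = 0"
      by (simp add: H_a)
    then have "(poly H a * z)\<^sup>2 + poly H a * (poly H a * z) + poly (Polynomial.smult c H) a = 0"
      by (simp add: algebra_simps power2_eq_square)
    then show False
      using a by blast
  qed
  then show thesis
    by (rule that)
qed

section \<open>The maximal ideal of a henselian valuation\<close>

locale residue_valued_field =
  fixes v :: "'a::field \<Rightarrow> 'g::linordered_ab_group_add"
    and res :: "'a \<Rightarrow> 'k::field"
  assumes valuation: "valuation v"
    and residue: "residue_map v res"
begin

abbreviation \<O> where "\<O> \<equiv> valuation_ring v"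
abbreviation \<mm> where "\<mm> \<equiv> valuation_ideal v"

section \<open>Arithmetic of the valuation ring and the residue map\<close>

lemma val_mult: "x \<noteq> 0 \<Longrightarrow> y \<noteq> 0 \<Longrightarrow> v (x * y) = v x + v y"
  using valuation by (simp add: valuation_def)

lemma val_add: "x \<noteq> 0 \<Longrightarrow> y \<noteq> 0 \<Longrightarrow> x + y \<noteq> 0 \<Longrightarrow> min (v x) (v y) \<le> v (x + y)"
  using valuation by (simp add: valuation_def)

lemma val_1: "v 1 = 0"
  using val_mult[of 1 1] by simp

lemma val_inverse: "x \<noteq> 0 \<Longrightarrow> v (inverse x) = - v x"
  using val_mult[of x "inverse x"] by (simp add: val_1 eq_neg_iff_add_eq_0 add.commute)

lemma val_minus_1: "v (- 1) = 0"
proof -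
  have "v (- 1) + v (- 1) = 0"
    using val_mult[of "- 1" "- 1"] by (simp add: val_1)
  then show ?thesis
    by simp
qed

lemma ring_0: "0 \<in> \<O>"
  by (simp add: valuation_ring_def)

lemma ring_1: "1 \<in> \<O>"
  by (simp add: valuation_ring_def val_1)

lemma ring_add: "x \<in> \<O> \<Longrightarrow> y \<in> \<O> \<Longrightarrow> x + y \<in> \<O>"
  using val_add[of x y] order_trans[of 0 "min (v x) (v y)" "v (x + y)"]
  by (cases "x = 0 \<or> y = 0 \<or> x + y = 0") (auto simp: valuation_ring_def)

lemma ring_mult: "x \<in> \<O> \<Longrightarrow> y \<in> \<O> \<Longrightarrow> x * y \<in> \<O>"
  by (cases "x = 0 \<or> y = 0") (auto simp: valuation_ring_def val_mult)

lemma ring_uminus: "x \<in> \<O> \<Longrightarrow> - x \<in> \<O>"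
  using ring_mult[of "- 1" x] by (simp add: valuation_ring_def val_minus_1)

lemma ring_diff: "x \<in> \<O> \<Longrightarrow> y \<in> \<O> \<Longrightarrow> x - y \<in> \<O>"
  using ring_add[of x "- y"] ring_uminus by simp

lemma ring_power: "x \<in> \<O> \<Longrightarrow> x ^ n \<in> \<O>"
  by (induction n) (simp_all add: ring_1 ring_mult)

lemma ring_numeral: "numeral n \<in> \<O>"
proof -
  have "of_nat m \<in> \<O>" for m
    by (induction m) (simp_all add: ring_0 ring_1 ring_add)
  from this[of "numeral n"] show ?thesis
    by simp
qed

lemmas ring_intros = ring_0 ring_1 ring_add ring_mult ring_uminus ring_diff ring_power ring_numeral

lemma ideal_subset: "x \<in> \<mm> \<Longrightarrow> x \<in> \<O>"
  by (auto simp: valuation_ring_def valuation_ideal_def)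

lemma inverse_mem_ideal: "x \<notin> \<O> \<Longrightarrow> inverse x \<in> \<mm>"
  by (auto simp: valuation_ring_def valuation_ideal_def val_inverse)

lemma inverse_mem_ring: "x \<in> \<O> \<Longrightarrow> x \<notin> \<mm> \<Longrightarrow> inverse x \<in> \<O>"
  by (auto simp: valuation_ring_def valuation_ideal_def val_inverse)

lemma res_eq_0_iff: "x \<in> \<O> \<Longrightarrow> res x = 0 \<longleftrightarrow> x \<in> \<mm>"
  using residue by (auto simp: residue_map_def)

lemma mem_ideal_iff: "x \<in> \<mm> \<longleftrightarrow> x \<in> \<O> \<and> res x = 0"
  using res_eq_0_iff ideal_subset by blast

lemma res_1: "res 1 = 1"
  using residue by (simp add: residue_map_def)

lemma res_add: "x \<in> \<O> \<Longrightarrow> y \<in> \<O> \<Longrightarrow> res (x + y) = res x + res y"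
  using residue by (simp add: residue_map_def)

lemma res_mult: "x \<in> \<O> \<Longrightarrow> y \<in> \<O> \<Longrightarrow> res (x * y) = res x * res y"
  using residue by (simp add: residue_map_def)

lemma res_0: "res 0 = 0"
  using res_eq_0_iff[OF ring_0] by (simp add: valuation_ideal_def)

lemma res_uminus: "x \<in> \<O> \<Longrightarrow> res (- x) = - res x"
  using res_add[of x "- x"] by (simp add: ring_uminus res_0 eq_neg_iff_add_eq_0 add.commute)

lemma res_diff: "x \<in> \<O> \<Longrightarrow> y \<in> \<O> \<Longrightarrow> res (x - y) = res x - res y"
  using res_add[of x "- y"] by (simp add: ring_uminus res_uminus)

lemma res_power: "x \<in> \<O> \<Longrightarrow> res (x ^ n) = res x ^ n"
  by (induction n) (simp_all add: res_1 res_mult ring_power)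

lemma res_numeral: "res (numeral n) = numeral n"
proof -
  have nat_mem: "of_nat m \<in> \<O>" for m
    by (induction m) (simp_all add: ring_0 ring_1 ring_add)
  have "res (of_nat m) = of_nat m" for m
    by (induction m) (simp_all add: res_0 res_1 res_add ring_1 nat_mem)
  from this[of "numeral n"] show ?thesis
    by simp
qed

lemmas res_simps = res_0 res_1 res_add res_mult res_uminus res_diff res_power res_numeral

lemma res_surj: obtains x where "x \<in> \<O>" "res x = y"
  using residue unfolding residue_map_def by (metis UNIV_I imageE)

lemma res_inverse: "x \<in> \<O> \<Longrightarrow> x \<notin> \<mm> \<Longrightarrow> res (inverse x) = inverse (res x)"
proof -
  assume x: "x \<in> \<O>" "x \<notin> \<mm>"
  then have "x \<noteq> 0" by (auto simp: valuation_ideal_def)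
  then have "res x * res (inverse x) = 1"
    using x by (simp flip: res_mult add: inverse_mem_ring res_1)
  then show ?thesis
    by (metis inverse_unique)
qed

lemma zero_mem_ideal: "0 \<in> \<mm>"
  by (simp add: valuation_ideal_def)

lemma ideal_mult: "x \<in> \<mm> \<Longrightarrow> y \<in> \<O> \<Longrightarrow> x * y \<in> \<mm>"
  by (auto simp: mem_ideal_iff ring_intros res_simps)

section \<open>Quadratics lifted from the residue field\<close>

lemma quadratic_integral:
  assumes "z\<^sup>2 + z \<in> \<O>"
  shows "z \<in> \<O>"
proof (rule ccontr)
  assume z: "z \<notin> \<O>"
  then have i: "inverse z \<in> \<mm>" and "z \<noteq> 0"
    using inverse_mem_ideal ring_0 by auto
  then have "1 = inverse z * (inverse z * (z\<^sup>2 + z) - 1)"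
    by (simp add: field_simps power2_eq_square)
  also have "\<dots> \<in> \<mm>"
    using i ideal_subset[OF ideal_mult[OF i assms]] by (intro ideal_mult ring_diff ring_1)
  finally show False
    by (simp add: mem_ideal_iff res_1)
qed

text \<open>For integral \<open>a\<close> the value is a unit, its residue being nonzero. Otherwise
  it is \<open>a\<close>^2 times \<open>u\<close> = 1 + 1/a + d/a^2, which has residue 1.\<close>

lemma residually_irreducible_value:
  assumes d: "d \<in> \<O>" and irred: "\<And>z. z\<^sup>2 + z + res d \<noteq> 0"
  shows "inverse (a\<^sup>2 + a + d) \<in> \<O>" and "a\<^sup>2 + a + d \<noteq> 0"
proof -
  have "inverse (a\<^sup>2 + a + d) \<in> \<O> \<and> a\<^sup>2 + a + d \<noteq> 0"
  proof (cases "a \<in> \<O>")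
    case True
    then have "a\<^sup>2 + a + d \<in> \<O>" "res (a\<^sup>2 + a + d) \<noteq> 0"
      using d irred[of "res a"] by (auto simp: ring_intros res_simps)
    then show ?thesis
      using inverse_mem_ring res_eq_0_iff res_0 by metis
  next
    case False
    define i where "i = inverse a"
    then have i: "i \<in> \<mm>" "i \<in> \<O>" "a \<noteq> 0"
      using False inverse_mem_ideal ideal_subset ring_0 by auto
    define u where "u = 1 + i + d * i\<^sup>2"
    have u: "u \<in> \<O>" "res u = 1"
      using i d unfolding u_def by (auto simp: ring_intros res_simps res_eq_0_iff[THEN iffD2])
    then have "u \<noteq> 0" "u \<notin> \<mm>"
      by (auto simp: mem_ideal_iff res_0)
    have "a\<^sup>2 + a + d = u * a\<^sup>2"
      using i by (simp add: u_def i_def field_simps power2_eq_square)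
    then have "inverse (a\<^sup>2 + a + d) = inverse u * i\<^sup>2"
      by (simp add: i_def power_inverse)
    then show ?thesis
      using u i \<open>u \<noteq> 0\<close> \<open>u \<notin> \<mm>\<close> \<open>a\<^sup>2 + a + d = u * a\<^sup>2\<close>
      by (auto intro!: ring_intros inverse_mem_ring)
  qed
  then show "inverse (a\<^sup>2 + a + d) \<in> \<O>" and "a\<^sup>2 + a + d \<noteq> 0" by auto
qed

text \<open>Any lift of a good residual specialization works: a zero would be integral by
  \<open>quadratic_integral\<close> and would reduce to a zero over the residue field.\<close>

lemma hilbertian_lift:
  assumes hilb: "hilbertian TYPE('k)"
    and d: "d \<in> \<O>" and irred: "\<And>z. z\<^sup>2 + z + res d \<noteq> 0"
    and c: "c \<in> \<O>" "c \<notin> \<mm>"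
  obtains a where "\<And>z. (a\<^sup>2 + a + d) * (z\<^sup>2 + z) + c \<noteq> 0"
proof -
  have "res c \<noteq> 0"
    using c by (simp add: res_eq_0_iff)
  with hilb irred obtain b
    where b: "\<And>z. (b\<^sup>2 + b + res d) * (z\<^sup>2 + z) + res c \<noteq> 0"
    by (rule hilbertian_obtains_quotient) blast
  obtain a where a: "a \<in> \<O>" "res a = b"
    by (rule res_surj)
  have "(a\<^sup>2 + a + d) * (z\<^sup>2 + z) + c \<noteq> 0" for z
  proof
    assume z: "(a\<^sup>2 + a + d) * (z\<^sup>2 + z) + c = 0"
    then have "z\<^sup>2 + z = - c * inverse (a\<^sup>2 + a + d)"
      using residually_irreducible_value[OF d irred, of a]
      by (simp add: field_simps eq_neg_iff_add_eq_0)
    also have "\<dots> \<in> \<O>"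
      using residually_irreducible_value[OF d irred, of a] c by (intro ring_intros)
    finally have "z \<in> \<O>"
      by (rule quadratic_integral)
    then have "(b\<^sup>2 + b + res d) * ((res z)\<^sup>2 + res z) + res c = 0"
      using arg_cong[OF z, of res] a c d by (simp add: ring_intros res_simps)
    then show False
      using b by blast
  qed
  then show thesis
    by (rule that)
qed

end

text \<open>
  The first conjunct says that \<open>x = 1 / h b - 1 / d\<close>
  with \<open>h T = T\<^sup>2 + T + d\<close>, which bounds \<open>x\<close>; the second that \<open>X\<^sup>2 + X + x / h a\<close> always has a zero.
\<close>

definition ideal_candidate :: "'a::field \<Rightarrow> 'a set" where
  "ideal_candidate d =
     {x. (\<exists>b. (x * d + 1) * (b\<^sup>2 + b + d) = d) \<and>
         (\<forall>a. \<exists>z. (a\<^sup>2 + a + d) * (z\<^sup>2 + z) + x = 0)}"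

text \<open>
  First-order properties of the maximal ideal of a valuation ring in which \<open>X\<^sup>2 + X + c\<close> has a
  zero whenever \<open>c\<close> lies in the maximal ideal.
\<close>

definition henselian_ideal_like :: "'a::field set \<Rightarrow> bool" where
  "henselian_ideal_like M \<longleftrightarrow>
     (\<forall>x y. x * y \<in> M \<longrightarrow> x \<in> M \<or> y \<in> M) \<and>
     (\<forall>y\<in>M. \<exists>z\<in>M. z * (1 + y) = y) \<and>
     (\<forall>y\<in>M. \<exists>z. z\<^sup>2 + z + y = 0)"

text \<open>Iterating y -> y/(1 + y) yields y/(1 + ny).\<close>

lemma henselian_ideal_like_divide:
  assumes M: "henselian_ideal_like M" and y: "y \<in> M"
  shows "\<exists>z\<in>M. z * (1 + of_nat n * y) = y"
proof (induction n)
  case 0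
  then show ?case using y by auto
next
  case (Suc n)
  then obtain w where w: "w \<in> M" "w * (1 + of_nat n * y) = y"
    by blast
  then obtain z where z: "z \<in> M" "z * (1 + w) = w"
    using M unfolding henselian_ideal_like_def by blast
  have "z * (1 + of_nat (Suc n) * y) = z * (1 + of_nat n * y + y)"
    by (simp add: algebra_simps)
  also have "\<dots> = z * (1 + of_nat n * y + w * (1 + of_nat n * y))"
    by (simp only: w(2))
  also have "\<dots> = z * (1 + w) * (1 + of_nat n * y)"
    by (simp add: algebra_simps)
  also have "\<dots> = y"
    by (simp add: z(2) w(2))
  finally show ?case
    using z(1) by blast
qed

context residue_valued_field
begin

text \<open>
  A witness in \<open>M\<close> outside the maximal ideal yields one that is a unit of the valuation ring, so
  Hilbert irreducibility makes \<open>h a / (1 - 4 d)\<close> a member of \<open>M\<close> for some \<open>a\<close>. Since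
  \<open>4 * h a = (2 * a + 1)\<^sup>2 - (1 - 4 d)\<close>, the quotient \<open>h a / (2 * a + 1)\<^sup>2\<close> is also in \<open>M\<close>, and the
  substitution \<open>X = a + (2 * a + 1) * Z\<close> produces a zero of the irreducible \<open>h\<close>.
\<close>

lemma henselian_ideal_like_subset:
  assumes hilb: "hilbertian TYPE('k)"
    and d: "d \<in> \<O>" and irred: "\<And>z. z\<^sup>2 + z + res d \<noteq> 0"
    and M: "henselian_ideal_like M"
  shows "M \<subseteq> \<mm>"
proof
  fix y assume y: "y \<in> M"
  show "y \<in> \<mm>"
  proof (rule ccontr)
    assume y_notin: "y \<notin> \<mm>"
    \<comment> \<open>If \<open>y\<close> is not integral, y/(1 + y) = 1/(1 + 1/y) is a unit of
      residue 1.\<close>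
    obtain c where c: "c \<in> M" "c \<in> \<O>" "c \<notin> \<mm>"
    proof (cases "y \<in> \<O>")
      case True
      then show thesis using that y y_notin by blast
    next
      case False
      obtain z where z: "z \<in> M" "z * (1 + y) = y"
        using M y unfolding henselian_ideal_like_def by blast
      have "y \<noteq> 0" using y_notin zero_mem_ideal by auto
      define i where "i = inverse y"
      have i: "i \<in> \<mm>"
        using False inverse_mem_ideal by (simp add: i_def)
      have z_i: "z * (1 + i) = 1"
        using z(2) \<open>y \<noteq> 0\<close> by (simp add: i_def field_simps)
      have i1: "1 + i \<in> \<O>" "res (1 + i) = 1"
        using i by (auto simp: ring_intros res_simps mem_ideal_iff)
      then have "inverse (1 + i) \<in> \<O>" "res (inverse (1 + i)) = 1"
        using inverse_mem_ring res_inverse by (auto simp: mem_ideal_iff)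
      moreover have "z = inverse (1 + i)"
        using z_i by (metis inverse_unique mult.commute)
      ultimately show thesis
        using that z(1) by (auto simp: mem_ideal_iff)
    qed
    define \<delta> where "\<delta> = 1 - 4 * d"
    have "res \<delta> \<noteq> 0"
    proof
      assume "res \<delta> = 0"
      then have eq: "4 * res d = 1"
        using d by (simp add: \<delta>_def ring_intros res_simps)
      then have "4 \<noteq> (0::'k)" by auto
      then have two: "2 \<noteq> (0::'k)"
        by (metis mult_2 numeral_Bit0 add_0)
      \<comment> \<open>\<delta> is the discriminant of h; if it vanished residually, -1/2 would be
        a double zero of the reduction of h. Characteristic 2 is excluded by 4 d = 1.\<close>
      define s where "s = - inverse (2::'k)"
      have s: "2 * s = - 1"
        using two by (simp add: s_def)
      have "4 * (s\<^sup>2 + s + res d) = (2 * s)\<^sup>2 + 2 * (2 * s) + 4 * res d"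
        by (simp add: algebra_simps power2_eq_square)
      also have "\<dots> = 0"
        unfolding s eq by simp
      finally show False
        using irred[of s] \<open>4 \<noteq> 0\<close> by (simp only: mult_eq_0_iff simp_thms)
    qed
    then have \<delta>: "\<delta> \<in> \<O>" "\<delta> \<notin> \<mm>" "\<delta> \<noteq> 0"
      using d by (auto simp: \<delta>_def ring_intros mem_ideal_iff res_0)
    then have "c * \<delta> \<in> \<O>" "c * \<delta> \<notin> \<mm>"
      using c by (auto simp: mem_ideal_iff ring_intros res_simps)
    with hilb d irred obtain a
      where a: "\<And>z. (a\<^sup>2 + a + d) * (z\<^sup>2 + z) + c * \<delta> \<noteq> 0"
      by (rule hilbertian_lift) blast
    let ?h = "a\<^sup>2 + a + d"
    have h: "?h \<noteq> 0"
      using residually_irreducible_value[OF d irred] by blast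
    \<comment> \<open>The factor \<delta> is included so that this quotient times h(a)/\<delta> is
      \<open>c\<close>. As the quotient is outside \<open>M\<close>, primeness puts h(a)/\<delta>
      into \<open>M\<close>.\<close>
    have "c * \<delta> / ?h \<notin> M"
    proof
      assume "c * \<delta> / ?h \<in> M"
      then obtain z where "z\<^sup>2 + z + c * \<delta> / ?h = 0"
        using M unfolding henselian_ideal_like_def by blast
      then have "?h * (z\<^sup>2 + z + c * \<delta> / ?h) = 0" by simp
      then have "?h * (z\<^sup>2 + z) + c * \<delta> = 0"
        using h by (simp only: distrib_left nonzero_mult_div_cancel_left times_divide_eq_right
            simp_thms not_False_eq_True)
      then show False using a by blast
    qed
    moreover have "c * \<delta> / ?h * (?h / \<delta>) = c"
      using h \<delta> by simp
    ultimately have "?h / \<delta> \<in> M"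
      using M c(1) unfolding henselian_ideal_like_def by metis
    \<comment> \<open>The multiple 4 is chosen because \<delta> + 4 h(a) is the square (2a + 1)^2,
      so that w = h(a)/(2a + 1)^2.\<close>
    then obtain w where w: "w \<in> M" "w * (1 + of_nat 4 * (?h / \<delta>)) = ?h / \<delta>"
      using henselian_ideal_like_divide[OF M] by blast
    have sq: "\<delta> + 4 * ?h = (2 * a + 1)\<^sup>2"
      by (simp add: \<delta>_def power2_eq_square algebra_simps)
    have "w * (\<delta> + 4 * k) = \<delta> * (w * (1 + of_nat 4 * (k / \<delta>)))" for k
      using \<delta> by (simp add: field_simps)
    then have "w * (\<delta> + 4 * ?h) = \<delta> * (w * (1 + of_nat 4 * (?h / \<delta>)))" .
    also have "\<dots> = ?h"
      using w \<delta> by simp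
    finally have w_h: "w * (2 * a + 1)\<^sup>2 = ?h"
      unfolding sq .
    obtain z where z: "z\<^sup>2 + z + w = 0"
      using M w unfolding henselian_ideal_like_def by blast
    have "(a + (2 * a + 1) * z)\<^sup>2 + (a + (2 * a + 1) * z) + d
        = (2 * a + 1)\<^sup>2 * (z\<^sup>2 + z) + ?h"
      by (simp add: power2_eq_square algebra_simps)
    also have "\<dots> = (2 * a + 1)\<^sup>2 * (z\<^sup>2 + z + w)"
      by (simp only: w_h[symmetric] distrib_left mult.commute[of w])
    also have "\<dots> = 0"
      by (simp add: z)
    finally show False
      using residually_irreducible_value[OF d irred] by blast
  qed
qed

section \<open>Recovering the maximal ideal without parameters\<close>

text \<open>Modulo the maximal ideal the polynomial is X^2 + X, with simple zero 0.\<close>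

lemma henselian_quadratic:
  assumes hens: "henselian v" and c: "c \<in> \<mm>"
  obtains z where "z\<^sup>2 + z + c = 0"
proof -
  have "\<exists>b\<in>\<O>. poly [:c, 1, 1:] b = 0 \<and> b - 0 \<in> \<mm>"
  proof (rule hens[unfolded henselian_def, rule_format])
    show "Polynomial.coeff [:c, 1, 1:] i \<in> \<O>" for i
      using c by (auto simp: coeff_pCons ring_intros ideal_subset split: nat.split)
    show "poly (pderiv [:c, 1, 1:]) 0 \<notin> \<mm>"
      by (simp add: pderiv_pCons mem_ideal_iff res_1)
  qed (use c in \<open>auto simp: ring_0\<close>)
  then show thesis
    using that by (auto simp: power2_eq_square algebra_simps)
qed

lemma ideal_candidate_eq:
  assumes hens: "henselian v" and hilb: "hilbertian TYPE('k)"
    and d: "d \<in> \<O>" and irred: "\<And>z. z\<^sup>2 + z + res d \<noteq> 0"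
  shows "ideal_candidate d = \<mm>"
proof (intro subset_antisym subsetI)
  have "res d \<noteq> 0"
    using irred[of 0] by simp
  then have d': "d \<noteq> 0" "d \<notin> \<mm>"
    by (auto simp: mem_ideal_iff res_0)
  fix x
  {
    assume x: "x \<in> \<mm>"
    have "(x * d + 1) \<in> \<O>" "res (x * d + 1) = 1"
      using x d by (auto simp: mem_ideal_iff ring_intros res_simps)
    then have u: "x * d + 1 \<noteq> 0" "inverse (x * d + 1) \<in> \<O>"
      by (auto simp: res_0 mem_ideal_iff intro!: inverse_mem_ring)
    \<comment> \<open>The equation h(b) = d/(xd + 1) amounts to b^2 + b + x d^2/(xd + 1) = 0, whose
      constant term lies in the maximal ideal.\<close>
    have "x * (d * d * inverse (x * d + 1)) \<in> \<mm>"
      using x d u by (intro ideal_mult ring_intros)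
    then obtain b where "b\<^sup>2 + b + x * (d * d * inverse (x * d + 1)) = 0"
      by (rule henselian_quadratic[OF hens])
    then have "(x * d + 1) * (b\<^sup>2 + b + x * (d * d * inverse (x * d + 1))) = 0"
      by simp
    then have "(x * d + 1) * (b\<^sup>2 + b) + x * d * d * ((x * d + 1) * inverse (x * d + 1)) = 0"
      by (simp add: algebra_simps)
    then have "(x * d + 1) * (b\<^sup>2 + b) + x * d * d = 0"
      using u by simp
    then have "(x * d + 1) * (b\<^sup>2 + b + d) = d"
      by (simp add: algebra_simps)
    moreover have "\<exists>z. (a\<^sup>2 + a + d) * (z\<^sup>2 + z) + x = 0" for a
    proof -
      note h = residually_irreducible_value[OF d irred, of a]
      have "x * inverse (a\<^sup>2 + a + d) \<in> \<mm>"
        using x h by (intro ideal_mult)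
      then obtain z where z: "z\<^sup>2 + z + x * inverse (a\<^sup>2 + a + d) = 0"
        by (rule henselian_quadratic[OF hens])
      then have "(a\<^sup>2 + a + d) * (z\<^sup>2 + z + x * inverse (a\<^sup>2 + a + d)) = 0"
        by simp
      then have "(a\<^sup>2 + a + d) * (z\<^sup>2 + z) + x * ((a\<^sup>2 + a + d) * inverse (a\<^sup>2 + a + d)) = 0"
        by (simp only: distrib_left mult.left_commute)
      then show ?thesis
        using h(2) by (intro exI[of _ z]) simp
    qed
    ultimately show "x \<in> ideal_candidate d"
      by (auto simp: ideal_candidate_def)
  next
    assume x: "x \<in> ideal_candidate d"
    then obtain b where b: "(x * d + 1) * (b\<^sup>2 + b + d) = d"
      by (auto simp: ideal_candidate_def)
    \<comment> \<open>The first condition gives x = 1/h(b) - 1/d, which is integral; were it a unit,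
      \<open>hilbertian_lift\<close> would contradict the second condition.\<close>
    note h = residually_irreducible_value[OF d irred, of b]
    have "x * d + 1 = d * inverse (b\<^sup>2 + b + d)"
      using b h(2) by (simp add: field_simps)
    then have "x = (d * inverse (b\<^sup>2 + b + d) - 1) * inverse d"
      using d' by (simp add: field_simps)
    also have "\<dots> \<in> \<O>"
      using h d inverse_mem_ring[OF d d'(2)] by (intro ring_mult ring_diff ring_1)
    finally have "x \<in> \<O>" .
    show "x \<in> \<mm>"
    proof (rule ccontr)
      assume "x \<notin> \<mm>"
      with hilb d irred \<open>x \<in> \<O>\<close> obtain a where "\<And>z. (a\<^sup>2 + a + d) * (z\<^sup>2 + z) + x \<noteq> 0"
        by (rule hilbertian_lift) blast
      then show False
        using x by (auto simp: ideal_candidate_def)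
    qed
  }
qed

lemma henselian_ideal_like_ideal:
  assumes hens: "henselian v"
  shows "henselian_ideal_like \<mm>"
  unfolding henselian_ideal_like_def
proof (intro conjI allI ballI impI)
  fix x y assume xy: "x * y \<in> \<mm>"
  show "x \<in> \<mm> \<or> y \<in> \<mm>"
  proof (rule ccontr)
    assume "\<not> (x \<in> \<mm> \<or> y \<in> \<mm>)"
    then have "x \<noteq> 0" "y \<noteq> 0" "v x \<le> 0" "v y \<le> 0"
      by (auto simp: valuation_ideal_def)
    then show False
      using xy add_nonpos_nonpos[of "v x" "v y"] by (auto simp: valuation_ideal_def val_mult)
  qed
next
  fix y assume y: "y \<in> \<mm>"
  then have "1 + y \<in> \<O>" "res (1 + y) = 1"
    by (auto simp: mem_ideal_iff ring_intros res_simps)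
  then have u: "1 + y \<noteq> 0" "inverse (1 + y) \<in> \<O>"
    by (auto simp: res_0 mem_ideal_iff intro!: inverse_mem_ring)
  then have "y * inverse (1 + y) \<in> \<mm>" "y * inverse (1 + y) * (1 + y) = y"
    using y ideal_mult by auto
  then show "\<exists>z\<in>\<mm>. z * (1 + y) = y"
    by blast
  show "\<exists>z. z\<^sup>2 + z + y = 0"
    using henselian_quadratic[OF hens y] by blast
qed

lemma valuation_ideal_eq_Union:
  assumes hens: "henselian v" and hilb: "hilbertian TYPE('k)"
  shows "\<mm> = \<Union> {ideal_candidate d | d. henselian_ideal_like (ideal_candidate d)}"
proof -
  obtain d' :: 'k where "\<And>z. z\<^sup>2 + z + d' \<noteq> 0"
    using hilbertian_obtains_irreducible[OF hilb] by blast
  moreover obtain d where "d \<in> \<O>" "res d = d'"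
    by (rule res_surj)
  ultimately have d: "d \<in> \<O>" "\<And>z. z\<^sup>2 + z + res d \<noteq> 0"
    by auto
  have candidate: "ideal_candidate d = \<mm>"
    using d by (rule ideal_candidate_eq[OF hens hilb])
  have below: "M \<subseteq> \<mm>" if "henselian_ideal_like M" for M
    using d that by (rule henselian_ideal_like_subset[OF hilb])
  show ?thesis
  proof (rule subset_antisym)
    have "henselian_ideal_like (ideal_candidate d)"
      using henselian_ideal_like_ideal[OF hens] by (simp only: candidate)
    then show "\<mm> \<subseteq> \<Union> {ideal_candidate d | d. henselian_ideal_like (ideal_candidate d)}"
      using candidate by blast
  qed (auto dest: below)
qed

text \<open>An element is nonintegral exactly when its inverse lies in the maximal ideal.\<close>

lemma mem_valuation_ring_iff: "x \<in> \<O> \<longleftrightarrow> \<not> (\<exists>w\<in>\<mm>. x * w = 1)"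
proof
  assume x: "x \<in> \<O>"
  show "\<not> (\<exists>w\<in>\<mm>. x * w = 1)"
  proof
    assume "\<exists>w\<in>\<mm>. x * w = 1"
    then have "1 \<in> \<mm>"
      using ideal_mult[OF _ x] by (metis mult.commute)
    then show False
      by (simp add: mem_ideal_iff res_1)
  qed
next
  assume no_inverse: "\<not> (\<exists>w\<in>\<mm>. x * w = 1)"
  show "x \<in> \<O>"
  proof (rule ccontr)
    assume "x \<notin> \<O>"
    moreover from this have "x \<noteq> 0"
      using ring_0 by metis
    ultimately have "inverse x \<in> \<mm>" "x * inverse x = 1"
      using inverse_mem_ideal by simp_all
    then show False
      using no_inverse by blast
  qed
qed

end

section \<open>The defining formula\<close>

definition RForall :: "nat \<Rightarrow> ring_formula \<Rightarrow> ring_formula" where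
  "RForall n \<phi> = RNot (REx n (RNot \<phi>))"

definition RImp :: "ring_formula \<Rightarrow> ring_formula \<Rightarrow> ring_formula" where
  "RImp \<phi> \<psi> = RNot (RAnd \<phi> (RNot \<psi>))"

definition quadratic_term :: "ring_term \<Rightarrow> ring_term" where
  "quadratic_term t = RAdd (RMul t t) t"

lemma holds_RForall [simp]: "holds e (RForall n \<phi>) \<longleftrightarrow> (\<forall>x. holds (e(n := x)) \<phi>)"
  and free_vars_RForall [simp]: "free_vars (RForall n \<phi>) = free_vars \<phi> - {n}"
  by (simp_all add: RForall_def)

lemma holds_RImp [simp]: "holds e (RImp \<phi> \<psi>) \<longleftrightarrow> (holds e \<phi> \<longrightarrow> holds e \<psi>)"
  and free_vars_RImp [simp]: "free_vars (RImp \<phi> \<psi>) = free_vars \<phi> \<union> free_vars \<psi>"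
  by (simp_all add: RImp_def)

lemma value_quadratic_term [simp]: "term_value e (quadratic_term t) = (term_value e t)\<^sup>2 + term_value e t"
  and vars_quadratic_term [simp]: "term_vars (quadratic_term t) = term_vars t"
  by (simp_all add: quadratic_term_def power2_eq_square)

text \<open>The variable \<open>1\<close> stands for the parameter \<open>d\<close>; the variables from \<open>5\<close> on are scratch.\<close>

definition ideal_candidate_formula :: "ring_term \<Rightarrow> ring_formula" where
  "ideal_candidate_formula t =
     RAnd
       (REx 5 (REq (RMul (RAdd (RMul t (RVar 1)) ROne) (RAdd (quadratic_term (RVar 5)) (RVar 1)))
                   (RVar 1)))
       (RForall 5 (REx 6 (REq
         (RAdd (RMul (RAdd (quadratic_term (RVar 5)) (RVar 1)) (quadratic_term (RVar 6))) t)
         RZero)))"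

definition ideal_like_formula :: ring_formula where
  "ideal_like_formula =
     RAnd
       (RForall 2 (RForall 3 (RImp (ideal_candidate_formula (RMul (RVar 2) (RVar 3)))
         (RImp (RNot (ideal_candidate_formula (RVar 2))) (ideal_candidate_formula (RVar 3))))))
       (RForall 2 (RImp (ideal_candidate_formula (RVar 2))
         (RAnd
           (REx 3 (RAnd (ideal_candidate_formula (RVar 3))
              (REq (RMul (RVar 3) (RAdd ROne (RVar 2))) (RVar 2))))
           (REx 3 (REq (RAdd (quadratic_term (RVar 3)) (RVar 2)) RZero)))))"

definition valuation_ring_formula :: ring_formula where
  "valuation_ring_formula =
     RNot (REx 1 (REx 4 (RAnd ideal_like_formula
       (RAnd (ideal_candidate_formula (RVar 4)) (REq (RMul (RVar 0) (RVar 4)) ROne)))))"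

lemma term_value_cong: "(\<And>n. n \<in> term_vars t \<Longrightarrow> e n = e' n) \<Longrightarrow> term_value e t = term_value e' t"
  by (induction t) auto

text \<open>The side conditions prevent the quantifiers over 5 and 6 from capturing variables of
  \<open>t\<close>.\<close>

lemma holds_ideal_candidate_formula:
  assumes "5 \<notin> term_vars t" "6 \<notin> term_vars t"
  shows "holds e (ideal_candidate_formula t) \<longleftrightarrow> term_value e t \<in> ideal_candidate (e 1)"
proof -
  have "term_value (e(5 := x)) t = term_value e t"
    "term_value (e(5 := x, 6 := y)) t = term_value e t" for x y
    by (rule term_value_cong; use assms in auto)+
  then show ?thesis
    by (simp add: ideal_candidate_formula_def ideal_candidate_def)
qed

lemma free_vars_ideal_candidate_formula:
  "free_vars (ideal_candidate_formula t) \<subseteq> insert 1 (term_vars t)"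
  by (auto simp: ideal_candidate_formula_def)

lemma holds_ideal_like_formula:
  "holds e ideal_like_formula \<longleftrightarrow> henselian_ideal_like (ideal_candidate (e 1))"
  by (simp add: ideal_like_formula_def henselian_ideal_like_def holds_ideal_candidate_formula) blast

lemma free_vars_valuation_ring_formula: "free_vars valuation_ring_formula \<subseteq> {0}"
  by (auto simp: valuation_ring_formula_def ideal_like_formula_def
      dest: free_vars_ideal_candidate_formula[THEN subsetD])

lemma holds_valuation_ring_formula:
  "holds e valuation_ring_formula \<longleftrightarrow>
     \<not> (\<exists>w \<in> \<Union> {ideal_candidate d | d. henselian_ideal_like (ideal_candidate d)}. e 0 * w = 1)"
  by (simp add: valuation_ring_formula_def holds_ideal_like_formula holds_ideal_candidate_formula) blast

theorem corollary3p3: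
  fixes v :: "'a::field \<Rightarrow> 'g::linordered_ab_group_add"
    and res :: "'a \<Rightarrow> 'k::field"
  assumes "valuation v"
    and "henselian v"
    and "residue_map v res"
    and "hilbertian TYPE('k)"
  shows "zero_definable_valuation v"
proof -
  interpret residue_valued_field v res
    using assms by unfold_locales
  have "e 0 \<in> valuation_ring v \<longleftrightarrow> holds e valuation_ring_formula" for e
    unfolding mem_valuation_ring_iff holds_valuation_ring_formula
      valuation_ideal_eq_Union[OF assms(2,4)] ..
  then show ?thesis
    unfolding zero_definable_valuation_def zero_definable_def
    using free_vars_valuation_ring_formula by blast
qed

end
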